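(* For all integers $p,q\geq0$ the Arf invariant of the quadratic form $\mu_{p,q}$ attached to the real Clifford algebra $\mathrm{Cl}_{p,q}(\mathbb{R})$ is given by $$\operatorname{Arf}(\mu_{p,q})=\operatorname{sign}\left(\cos\frac{(p-q)\pi}{4}+\sin\frac{(p-q)\pi}{4}\right)=\begin{cases}1&\text{if }p-q+1\equiv1,2,3\pmod 8\\0&\text{if }p-q+1\equiv0,4\pmod 8\\-1&\text{if }p-q+1\equiv5,6,7\pmod 8.\end{cases}$$
   Context: $\mathrm{Cl}_{p,q}(\mathbb{R})$ is the Clifford algebra $T(V)/\langle v\otimes v-Q(v)1\mid v\in V\rangle$ of a real vector space $V$ of dimension $N=p+q$ with a quadratic form $Q$ and an orthogonal basis $v_1,\dots,v_N$ such that $Q(v_1)=\dots=Q(v_p)=+1$ and $Q(v_{p+1})=\dots=Q(v_N)=-1$. Thus $v_i^2=Q(v_i)$ and $v_iv_j=-v_jv_i$ for $i\neq j$. For $I=\{i_1<\dots<i_r\}\subseteq\{1,\dots,N\}$ put $v_I=v_{i_1}\cdots v_{i_r}$, $v_\emptyset=1$. The algebra is graded by $\mathbb{Z}_2^N$ with $v_i$ of degree the $i$-th standard basis vector, so $v_I$ spans the component whose degree is the indicator vector of $I$. The map $\mu_{p,q}:\mathbb{Z}_2^N\to\{\pm1\}$ is defined by $v_I^2=\mu_{p,q}(\deg v_I)1$. For a map $\mu:T\to\{\pm1\}$ on a finite set, $\operatorname{Arf}(\mu)=\operatorname{sign}(|\mu^{-1}(+1)|-|\mu^{-1}(-1)|)$,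 where $\operatorname{sign}(x)\in\{\pm1\}$ is the sign of a nonzero real number $x$ and $\operatorname{sign}(0)=0$. *)

theory Defs
  imports Complex_Main "HOL-Library.FuncSet" "HOL-Library.Z2" "HOL-Algebra.QuotRing"
begin

section \<open>Quadratic forms\<close>

definition polar_form :: "('v::real_vector \<Rightarrow> real) \<Rightarrow> 'v \<Rightarrow> 'v \<Rightarrow> real" where
  "polar_form Q x y = Q (x + y) - Q x - Q y"

text \<open>The polar form is symmetric, so linearity in the first argument makes it bilinear.\<close>

definition quadratic_form :: "'v::real_vector set \<Rightarrow> ('v \<Rightarrow> real) \<Rightarrow> bool" where
  "quadratic_form V Q \<longleftrightarrow>
     (\<forall>x\<in>V. \<forall>c. Q (c *\<^sub>R x) = c\<^sup>2 * Q x) \<and>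
     (\<forall>x\<in>V. \<forall>y\<in>V. \<forall>z\<in>V. polar_form Q (x + y) z = polar_form Q x z + polar_form Q y z) \<and>
     (\<forall>x\<in>V. \<forall>z\<in>V. \<forall>c. polar_form Q (c *\<^sub>R x) z = c * polar_form Q x z)"

definition orthogonal_basis ::
  "'v::real_vector set \<Rightarrow> ('v \<Rightarrow> real) \<Rightarrow> nat \<Rightarrow> (nat \<Rightarrow> 'v) \<Rightarrow> bool" where
  "orthogonal_basis V Q N v \<longleftrightarrow>
     inj_on v {1..N} \<and> independent (v ` {1..N}) \<and> span (v ` {1..N}) = V \<and>
     (\<forall>i\<in>{1..N}. \<forall>j\<in>{1..N}. i \<noteq> j \<longrightarrow> polar_form Q (v i) (v j) = 0)"

section \<open>The tensor algebra\<close>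

text \<open>
  The tensor algebra of \<open>V\<close> is obtained from the free associative unital real algebra on the
  underlying set of \<open>V\<close> by imposing linearity of the map sending a vector to its generator.
  An element of the free algebra is a finitely supported real function on words in \<open>V\<close>;
  words multiply by concatenation.
\<close>

definition free_algebra :: "'v set \<Rightarrow> ('v list \<Rightarrow> real) ring" where
  "free_algebra V =
     \<lparr>carrier = {f. finite {w. f w \<noteq> 0} \<and> {w. f w \<noteq> 0} \<subseteq> lists V},
      mult = (\<lambda>f g w. \<Sum>(w1, w2) \<in> {(w1, w2). w1 @ w2 = w}. f w1 * g w2),
      one = (\<lambda>w. if w = [] then 1 else 0),
      zero = (\<lambda>w. 0),
      add = (\<lambda>f g w. f w + g w)\<rparr>"

definition free_scalar :: "real \<Rightarrow> 'v list \<Rightarrow> real" where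
  "free_scalar c = (\<lambda>w. if w = [] then c else 0)"

definition free_gen :: "'v \<Rightarrow> 'v list \<Rightarrow> real" where
  "free_gen x = (\<lambda>w. if w = [x] then 1 else 0)"

definition tensor_ideal :: "'v::real_vector set \<Rightarrow> ('v list \<Rightarrow> real) set" where
  "tensor_ideal V = (let F = free_algebra V in
     Idl\<^bsub>F\<^esub>
      ({free_gen (x + y) \<ominus>\<^bsub>F\<^esub> (free_gen x \<oplus>\<^bsub>F\<^esub> free_gen y) | x y. x \<in> V \<and> y \<in> V} \<union>
       {free_gen (c *\<^sub>R x) \<ominus>\<^bsub>F\<^esub> (free_scalar c \<otimes>\<^bsub>F\<^esub> free_gen x) | c x. x \<in> V}))"

definition tensor_algebra :: "'v::real_vector set \<Rightarrow> ('v list \<Rightarrow> real) set ring" where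
  "tensor_algebra V = free_algebra V Quot tensor_ideal V"

text \<open>The canonical maps from the reals (\<open>c\<close> goes to \<open>c\<close> times the unit) and from \<open>V\<close>.\<close>

definition tensor_scalar :: "'v::real_vector set \<Rightarrow> real \<Rightarrow> ('v list \<Rightarrow> real) set" where
  "tensor_scalar V c = tensor_ideal V +>\<^bsub>free_algebra V\<^esub> free_scalar c"

definition tensor_vec :: "'v::real_vector set \<Rightarrow> 'v \<Rightarrow> ('v list \<Rightarrow> real) set" where
  "tensor_vec V x = tensor_ideal V +>\<^bsub>free_algebra V\<^esub> free_gen x"

section \<open>The Clifford algebra\<close>

definition clifford_ideal ::
  "'v::real_vector set \<Rightarrow> ('v \<Rightarrow> real) \<Rightarrow> ('v list \<Rightarrow> real) set set" where
  "clifford_ideal V Q = (let T = tensor_algebra V in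
     Idl\<^bsub>T\<^esub> {(tensor_vec V x \<otimes>\<^bsub>T\<^esub> tensor_vec V x) \<ominus>\<^bsub>T\<^esub> tensor_scalar V (Q x) | x. x \<in> V})"

definition clifford_algebra ::
  "'v::real_vector set \<Rightarrow> ('v \<Rightarrow> real) \<Rightarrow> ('v list \<Rightarrow> real) set set ring" where
  "clifford_algebra V Q = tensor_algebra V Quot clifford_ideal V Q"

definition clifford_scalar ::
  "'v::real_vector set \<Rightarrow> ('v \<Rightarrow> real) \<Rightarrow> real \<Rightarrow> ('v list \<Rightarrow> real) set set" where
  "clifford_scalar V Q c = clifford_ideal V Q +>\<^bsub>tensor_algebra V\<^esub> tensor_scalar V c"

definition clifford_vec ::
  "'v::real_vector set \<Rightarrow> ('v \<Rightarrow> real) \<Rightarrow> 'v \<Rightarrow> ('v list \<Rightarrow> real) set set" where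
  "clifford_vec V Q x = clifford_ideal V Q +>\<^bsub>tensor_algebra V\<^esub> tensor_vec V x"

text \<open>For \<open>I = {i\<^sub>1 < \<dots> < i\<^sub>r}\<close> this is the product of the \<open>v i\<^sub>k\<close> in increasing order of indices.\<close>

definition clifford_monomial ::
  "'v::real_vector set \<Rightarrow> ('v \<Rightarrow> real) \<Rightarrow> (nat \<Rightarrow> 'v) \<Rightarrow> nat set \<Rightarrow> ('v list \<Rightarrow> real) set set" where
  "clifford_monomial V Q v I =
     foldr (\<lambda>i a. clifford_vec V Q (v i) \<otimes>\<^bsub>clifford_algebra V Q\<^esub> a)
       (sorted_list_of_set I) \<one>\<^bsub>clifford_algebra V Q\<^esub>"

section \<open>The map \<open>\<mu>\<close> and the Arf invariant\<close>

definition Z2_power :: "nat \<Rightarrow> (nat \<Rightarrow> bit) set" where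
  "Z2_power N = {1..N} \<rightarrow>\<^sub>E UNIV"

definition monomial_degree :: "nat \<Rightarrow> nat set \<Rightarrow> nat \<Rightarrow> bit" where
  "monomial_degree N I = (\<lambda>i\<in>{1..N}. if i \<in> I then 1 else 0)"

definition clifford_mu ::
  "'v::real_vector set \<Rightarrow> ('v \<Rightarrow> real) \<Rightarrow> nat \<Rightarrow> (nat \<Rightarrow> 'v) \<Rightarrow> (nat \<Rightarrow> bit) \<Rightarrow> real" where
  "clifford_mu V Q N v t = (THE e. e \<in> {1, -1} \<and>
     (\<forall>I. I \<subseteq> {1..N} \<and> monomial_degree N I = t \<longrightarrow>
        clifford_monomial V Q v I \<otimes>\<^bsub>clifford_algebra V Q\<^esub> clifford_monomial V Q v I
          = clifford_scalar V Q e))"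

definition Arf :: "'t set \<Rightarrow> ('t \<Rightarrow> real) \<Rightarrow> real" where
  "Arf T \<mu> = sgn (real (card {t \<in> T. \<mu> t = 1}) - real (card {t \<in> T. \<mu> t = -1}))"

end

theory Submission
  imports Defs
begin

text \<open>
  Anticommutation gives \<open>v\<^sub>I\<^sup>2 = (-1)\<^bsup>r(r-1)/2\<^esup> \<Prod>\<^sub>i\<^sub>\<in>\<^sub>I Q(v\<^sub>i)\<close> for \<open>r = |I|\<close>. Since the sign is the real part of
  \<open>(1 - \<i>) \<i>\<^sup>r\<close>, the sum of all values of \<open>\<mu>\<close> is
  \<open>Re ((1 - \<i>) (1 + \<i>)\<^sup>p (1 - \<i>)\<^sup>q) = 2\<^bsup>(p+q)/2\<^esup> (cos ((p - q) \<pi> / 4) + sin ((p - q) \<pi> / 4))\<close>,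
  and the Arf invariant is its sign. For \<open>\<mu>\<close> to be well defined, \<open>1\<close> and \<open>-1\<close> must differ in the
  Clifford algebra: it acts on the real functions on sets of indices by signed flips of membership,
  so the relations do not kill the nonzero scalars.
\<close>

section \<open>The sum of the signs\<close>

lemma sum_Pow_insert:
  fixes h :: "'a set \<Rightarrow> 'b::comm_monoid_add"
  assumes "finite A" "a \<notin> A"
  shows "(\<Sum>I\<in>Pow (insert a A). h I) = (\<Sum>I\<in>Pow A. h I + h (insert a I))"
proof -
  have inj: "inj_on (insert a) (Pow A)"
    using assms(2) by (auto simp: inj_on_def)
  have "(\<Sum>I\<in>Pow (insert a A). h I) = (\<Sum>I\<in>Pow A. h I) + (\<Sum>I\<in>insert a ` Pow A. h I)"
    unfolding Pow_insert using assms by (intro sum.union_disjoint) auto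
  also have "(\<Sum>I\<in>insert a ` Pow A. h I) = (\<Sum>I\<in>Pow A. h (insert a I))"
    by (subst sum.reindex[OF inj]) simp
  finally show ?thesis
    by (simp add: sum.distrib)
qed

text \<open>Multiplying out the right side, the choice of \<open>1\<close> or \<open>f i\<close> in
  each factor amounts to a subset of \<open>A\<close>. A sum over all index sets thereby becomes a
  product with one factor per generator.\<close>

lemma sum_Pow_prod:
  fixes f :: "'a \<Rightarrow> 'b::comm_semiring_1"
  assumes "finite A"
  shows "(\<Sum>I\<in>Pow A. \<Prod>i\<in>I. f i) = (\<Prod>i\<in>A. 1 + f i)"
  using assms
proof (induction A rule: finite_induct)
  case (insert a A)
  have "(\<Sum>I\<in>Pow (insert a A). prod f I) = (\<Sum>I\<in>Pow A. (1 + f a) * prod f I)"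
    unfolding sum_Pow_insert[OF insert(1,2)]
  proof (intro sum.cong refl)
    fix I assume "I \<in> Pow A"
    then have "finite I" "a \<notin> I"
      using insert(1,2) finite_subset by auto
    then show "prod f I + prod f (insert a I) = (1 + f a) * prod f I"
      by (simp add: algebra_simps)
  qed
  then show ?case
    using insert by (simp flip: sum_distrib_left)
qed simp

text \<open>Both sides run through +1, +1, -1, -1 with period 4: raising \<open>r\<close> by two
  multiplies the left side by -1 and raises the binomial coefficient by the odd number
  \<open>2 * r + 1\<close>. The power of \<open>\<i>\<close> is multiplicative over the members of
  an index set, which the sign itself is not.\<close>

lemma Re_i_power_eq_sign: "Re ((1 - \<i>) * \<i> ^ r) = (-1) ^ (r choose 2)"
proof (induction r rule: induct_nat_012)
  case (ge2 n)
  have "Suc (Suc n) choose 2 = (n choose 2) + 2 * n + 1"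
    by (simp add: numeral_2_eq_2)
  then show ?case
    using ge2 by (simp add: power_add power_mult)
qed (simp_all add: numeral_2_eq_2)

text \<open>With the real part taken last, \<open>\<i> ^ card I\<close> spreads over the members of
  \<open>I\<close>, so the sum factors over the generators: a positive one contributes
  \<open>1 + \<i>\<close> and a negative one \<open>1 - \<i>\<close>.\<close>

lemma sum_clifford_signs:
  fixes p q :: nat and d :: "nat \<Rightarrow> real"
  assumes pos: "\<And>i. i \<in> {1..p} \<Longrightarrow> d i = 1" and neg: "\<And>i. i \<in> {p+1..p+q} \<Longrightarrow> d i = -1"
  shows "(\<Sum>I\<in>Pow {1..p+q}. (-1) ^ (card I choose 2) * (\<Prod>i\<in>I. d i))
           = sqrt 2 ^ (p + q) * (cos (real_of_int (int p - int q) * pi / 4)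
               + sin (real_of_int (int p - int q) * pi / 4))"
proof -
  define t where "t = pi / 4"
  define x where "x = real_of_int (int p - int q) * pi / 4"
  \<comment> \<open>Polar forms with common modulus and opposite angles, ready for De
    Moivre.\<close>
  have plus: "1 + \<i> = of_real (sqrt 2) * cis t" and minus: "1 - \<i> = of_real (sqrt 2) * cis (- t)"
    by (auto simp: complex_eq_iff t_def cos_45 sin_45)
  have "(\<Sum>I\<in>Pow {1..p+q}. (-1) ^ (card I choose 2) * (\<Prod>i\<in>I. d i))
      = (\<Sum>I\<in>Pow {1..p+q}. Re ((1 - \<i>) * (\<Prod>i\<in>I. \<i> * of_real (d i))))"
  proof (intro sum.cong refl)
    fix I :: "nat set"
    have "(1 - \<i>) * (\<Prod>i\<in>I. \<i> * of_real (d i))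
        = of_real (\<Prod>i\<in>I. d i) * ((1 - \<i>) * \<i> ^ card I)"
      by (simp add: prod.distrib)
    then have "Re ((1 - \<i>) * (\<Prod>i\<in>I. \<i> * of_real (d i)))
        = (\<Prod>i\<in>I. d i) * Re ((1 - \<i>) * \<i> ^ card I)"
      by (simp only: Re_complex_of_real Im_complex_of_real times_complex.sel)
    then show "(-1) ^ (card I choose 2) * (\<Prod>i\<in>I. d i)
        = Re ((1 - \<i>) * (\<Prod>i\<in>I. \<i> * of_real (d i)))"
      by (simp only: Re_i_power_eq_sign mult.commute)
  qed
  also have "\<dots> = Re ((1 - \<i>) * (\<Prod>i\<in>{1..p+q}. 1 + \<i> * of_real (d i)))"
    by (subst sum_Pow_prod[symmetric]) (simp_all only: finite_atLeastAtMost sum_distrib_left Re_sum)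
  also have "(\<Prod>i\<in>{1..p+q}. 1 + \<i> * of_real (d i))
      = (\<Prod>i\<in>{1..p}. 1 + \<i> * of_real (d i)) * (\<Prod>i\<in>{p+1..p+q}. 1 + \<i> * of_real (d i))"
  proof -
    have "{1..p+q} = {1..p} \<union> {p+1..p+q}"
      by auto
    then show ?thesis
      by (simp only:) (rule prod.union_disjoint; auto)
  qed
  also have "(\<Prod>i\<in>{1..p}. 1 + \<i> * of_real (d i)) = (\<Prod>i\<in>{1..p}. 1 + \<i>)"
    using pos by (intro prod.cong) auto
  also have "(\<Prod>i\<in>{p+1..p+q}. 1 + \<i> * of_real (d i)) = (\<Prod>i\<in>{p+1..p+q}. 1 - \<i>)"
    using neg by (intro prod.cong) auto
  also have "(1 - \<i>) * ((\<Prod>i\<in>{1..p}. 1 + \<i>) * (\<Prod>i\<in>{p+1..p+q}. 1 - \<i>))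
      = (1 - \<i>) * ((1 + \<i>) ^ p * (1 - \<i>) ^ q)"
    by simp
  also have "(1 + \<i>) ^ p * (1 - \<i>) ^ q = of_real (sqrt 2 ^ (p + q)) * cis x"
  proof -
    \<comment> \<open>Each of the \<open>p\<close> positive generators turns the product by
      \<open>t\<close>, each of the \<open>q\<close> negative ones by \<open>- t\<close>.\<close>
    have "x = real p * t + real q * (- t)"
      by (simp add: x_def t_def field_simps)
    then show ?thesis
      unfolding plus minus power_mult_distrib Complex.DeMoivre
      by (simp add: cis_mult power_add mult_ac)
  qed
  also have "Re ((1 - \<i>) * (of_real (sqrt 2 ^ (p + q)) * cis x)) = sqrt 2 ^ (p + q) * (cos x + sin x)"
    by (simp del: of_real_power add: algebra_simps)
  finally show ?thesis
    unfolding x_def .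
qed

text \<open>The left side has period 8 in \<open>k\<close>, so eight values decide. The shift by 1
  in the residues reflects that \<open>cos x + sin x\<close> equals
  \<open>sqrt 2 * sin (x + pi / 4)\<close>.\<close>

lemma sgn_cos_plus_sin:
  fixes k :: int
  shows "sgn (cos (real_of_int k * pi / 4) + sin (real_of_int k * pi / 4))
           = (if (k + 1) mod 8 \<in> {1, 2, 3} then 1
              else if (k + 1) mod 8 \<in> {0, 4} then 0
              else -1)"
proof -
  define r where "r = k mod 8"
  define y where "y = real_of_int r * pi / 4"
  have "k = 8 * (k div 8) + r"
    by (simp add: r_def)
  then have "real_of_int k = 8 * real_of_int (k div 8) + real_of_int r"
    by (metis of_int_add of_int_mult of_int_numeral)
  then have arg: "real_of_int k * pi / 4 = y + 2 * pi * real_of_int (k div 8)"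
    by (simp add: y_def field_simps)
  have periodic: "cos (real_of_int k * pi / 4) = cos y" "sin (real_of_int k * pi / 4) = sin y"
    unfolding arg by (simp_all add: cos_add sin_add)
  have mod: "(k + 1) mod 8 = (r + 1) mod 8"
    by (simp add: r_def mod_simps)
  \<comment> \<open>Quarter turns reduce the residues 3, 5 and 7 to the angle \<open>pi / 4\<close>,
    and 6 to \<open>pi\<close>.\<close>
  have quarter: "cos (x + pi / 2) = - sin x" "sin (x + pi / 2) = cos x" for x :: real
    by (simp_all add: cos_add sin_add)
  have diagonal: "cos (pi / 4) = sqrt 2 / 2" "sin (pi / 4) = sqrt 2 / 2"
    by (simp_all add: cos_45 sin_45)
  have "cos y + sin y = 1" if "r = 0"
    using that by (simp add: y_def)
  moreover have "cos y + sin y = sqrt 2" if "r = 1"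
    using that by (simp add: y_def diagonal)
  moreover have "cos y + sin y = 1" if "r = 2"
    using that by (simp add: y_def)
  moreover have "cos y + sin y = 0" if "r = 3"
  proof -
    have "y = pi / 4 + pi / 2" using that by (simp add: y_def)
    then show ?thesis by (simp only: quarter diagonal)
  qed
  moreover have "cos y + sin y = -1" if "r = 4"
    using that by (simp add: y_def)
  moreover have "cos y + sin y = - sqrt 2" if "r = 5"
  proof -
    have "y = pi / 4 + pi / 2 + pi / 2" using that by (simp add: y_def)
    then show ?thesis by (simp only: quarter diagonal)
  qed
  moreover have "cos y + sin y = -1" if "r = 6"
  proof -
    have "y = pi + pi / 2" using that by (simp add: y_def)
    then show ?thesis by (simp only: quarter) simp
  qed
  moreover have "cos y + sin y = 0" if "r = 7"
  proof -
    have "y = pi / 4 + pi / 2 + pi / 2 + pi / 2" using that by (simp add: y_def)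
    then show ?thesis by (simp only: quarter diagonal)
  qed
  moreover have "r \<in> {0, 1, 2, 3, 4, 5, 6, 7}"
    unfolding r_def by simp presburger
  ultimately show ?thesis
    unfolding periodic mod by (elim insertE emptyE) simp_all
qed

section \<open>The free algebra\<close>

lemma free_algebra_simps:
  "carrier (free_algebra V) = {f. finite {w. f w \<noteq> 0} \<and> {w. f w \<noteq> 0} \<subseteq> lists V}"
  "f \<otimes>\<^bsub>free_algebra V\<^esub> g = (\<lambda>w. \<Sum>(a, b) \<in> {(a, b). a @ b = w}. f a * g b)"
  "\<one>\<^bsub>free_algebra V\<^esub> = free_scalar 1"
  "\<zero>\<^bsub>free_algebra V\<^esub> = (\<lambda>w. 0)"
  "f \<oplus>\<^bsub>free_algebra V\<^esub> g = (\<lambda>w. f w + g w)"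
  by (simp_all add: free_algebra_def free_scalar_def)

text \<open>A split is determined by the length of its first part, so the convolution defining the
  product is a finite sum.\<close>

lemma splits_eq_image: "{(a, b). a @ b = w} = (\<lambda>n. (take n w, drop n w)) ` {..length w}"
proof -
  have "(a, b) \<in> (\<lambda>n. (take n w, drop n w)) ` {..length w}" if "a @ b = w" for a b
    using that by (intro image_eqI[of _ _ "length a"]) auto
  then show ?thesis by auto
qed

lemma finite_splits [simp]: "finite {(a, b). a @ b = w}"
  by (simp add: splits_eq_image)

text \<open>
  The linear extension of \<open>L\<close> from words to the free algebra, evaluated at \<open>f\<close>. Elements of the free
  algebra are compared through these functionals, which turns products of elements into
  concatenation of words.
\<close>

definition word_pairing :: "('v list \<Rightarrow> real) \<Rightarrow> ('v list \<Rightarrow> real) \<Rightarrow> real" where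
  "word_pairing f L = (\<Sum>w | f w \<noteq> 0. f w * L w)"

text \<open>Cancellation can make the support of a sum or product smaller than the supports of its
  parts suggest; a common finite superset avoids tracking this.\<close>

lemma word_pairing_superset:
  assumes "finite A" "{w. f w \<noteq> 0} \<subseteq> A"
  shows "word_pairing f L = (\<Sum>w\<in>A. f w * L w)"
  unfolding word_pairing_def using assms by (intro sum.mono_neutral_left) auto

lemma word_pairing_add:
  assumes "f \<in> carrier (free_algebra V)" "g \<in> carrier (free_algebra V)"
  shows "word_pairing (\<lambda>w. f w + g w) L = word_pairing f L + word_pairing g L"
proof -
  let ?A = "{w. f w \<noteq> 0} \<union> {w. g w \<noteq> 0}"
  have "finite ?A"
    using assms by (simp add: free_algebra_simps)
  then show ?thesis
    by (subst (1 2 3) word_pairing_superset[of ?A])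
      (auto simp: algebra_simps sum.distrib)
qed

lemma word_pairing_uminus: "word_pairing (\<lambda>w. - f w) L = - word_pairing f L"
  by (simp add: word_pairing_def sum_negf)

lemma word_pairing_scalar: "word_pairing (free_scalar c) L = c * L []"
  by (subst word_pairing_superset[of "{[]}"]) (auto simp: free_scalar_def split: if_splits)

lemma word_pairing_gen: "word_pairing (free_gen x) L = L [x]"
  by (subst word_pairing_superset[of "{[x]}"]) (auto simp: free_gen_def split: if_splits)

text \<open>A nonzero convolution sum has a nonzero term, and that term splits the word into one
  word from each support.\<close>

lemma free_mult_support:
  "{w. (\<Sum>(a, b) \<in> {(a, b). a @ b = w}. f a * g b :: real) \<noteq> 0}
     \<subseteq> (\<lambda>(a, b). a @ b) ` ({a. f a \<noteq> 0} \<times> {b. g b \<noteq> 0})"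
proof
  fix w assume "w \<in> {w. (\<Sum>(a, b) \<in> {(a, b). a @ b = w}. f a * g b) \<noteq> 0}"
  then obtain ab where "ab \<in> {(a, b). a @ b = w}" "(case ab of (a, b) \<Rightarrow> f a * g b) \<noteq> 0"
    using sum.not_neutral_contains_not_neutral by blast
  then show "w \<in> (\<lambda>(a, b). a @ b) ` ({a. f a \<noteq> 0} \<times> {b. g b \<noteq> 0})"
    by (auto intro!: image_eqI[of _ _ ab] split: prod.splits)
qed

lemma free_mult_closed:
  assumes "f \<in> carrier (free_algebra V)" "g \<in> carrier (free_algebra V)"
  shows "f \<otimes>\<^bsub>free_algebra V\<^esub> g \<in> carrier (free_algebra V)"
proof -
  have "finite ({a. f a \<noteq> 0} \<times> {b. g b \<noteq> 0})"
    using assms by (simp add: free_algebra_simps)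
  then have "finite {w. (\<Sum>(a, b) \<in> {(a, b). a @ b = w}. f a * g b) \<noteq> 0}"
    using free_mult_support finite_imageI finite_subset by metis
  moreover have "(\<lambda>(a, b). a @ b) ` ({a. f a \<noteq> 0} \<times> {b. g b \<noteq> 0}) \<subseteq> lists V"
    using assms by (auto simp: free_algebra_simps dest!: subsetD)
  ultimately show ?thesis
    unfolding free_algebra_simps using order_trans[OF free_mult_support[of f g]] by blast
qed

text \<open>Bilinear expansion, regrouped by the concatenated word. Nested pairings turn
  associativity of the product into associativity of \<open>@\<close>.\<close>

lemma word_pairing_mult:
  assumes "f \<in> carrier (free_algebra V)" "g \<in> carrier (free_algebra V)"
  shows "word_pairing (f \<otimes>\<^bsub>free_algebra V\<^esub> g) L
           = word_pairing f (\<lambda>a. word_pairing g (\<lambda>b. L (a @ b)))"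
proof -
  let ?S = "{a. f a \<noteq> 0} \<times> {b. g b \<noteq> 0}"
  let ?A = "(\<lambda>(a, b). a @ b) ` ?S"
  have fin: "finite ?S"
    using assms by (simp add: free_algebra_simps)
  have "word_pairing (f \<otimes>\<^bsub>free_algebra V\<^esub> g) L
      = (\<Sum>w\<in>?A. (\<Sum>(a, b) \<in> {(a, b). a @ b = w}. f a * g b) * L w)"
    unfolding free_algebra_simps using fin free_mult_support by (intro word_pairing_superset) auto
  also have "\<dots> = (\<Sum>w\<in>?A. \<Sum>(a, b) \<in> {ab \<in> ?S. (case ab of (a, b) \<Rightarrow> a @ b) = w}. f a * (g b * L (a @ b)))"
  proof (intro sum.cong refl)
    fix w
    have "(\<Sum>(a, b) \<in> {(a, b). a @ b = w}. f a * g b) * L w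
        = (\<Sum>(a, b) \<in> {(a, b). a @ b = w}. f a * (g b * L (a @ b)))"
      unfolding sum_distrib_right by (intro sum.cong) (auto simp: mult_ac)
    \<comment> \<open>Splits with a part outside its support contribute zero.\<close>
    also have "\<dots> = (\<Sum>(a, b) \<in> {ab \<in> ?S. (case ab of (a, b) \<Rightarrow> a @ b) = w}. f a * (g b * L (a @ b)))"
      by (intro sum.mono_neutral_right) auto
    finally show "(\<Sum>(a, b) \<in> {(a, b). a @ b = w}. f a * g b) * L w = \<dots>" .
  qed
  \<comment> \<open>The inner sums run over the fibres of concatenation on
    \<open>?S\<close>.\<close>
  also have "\<dots> = (\<Sum>(a, b)\<in>?S. f a * (g b * L (a @ b)))"
    by (rule sum.image_gen[OF fin, symmetric])
  also have "\<dots> = word_pairing f (\<lambda>a. word_pairing g (\<lambda>b. L (a @ b)))"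
    by (simp add: word_pairing_def sum.cartesian_product[symmetric] sum_distrib_left)
  finally show ?thesis .
qed

lemma word_pairing_delta:
  assumes "f \<in> carrier (free_algebra V)"
  shows "word_pairing f (\<lambda>w. if w = u then 1 else 0) = f u"
proof -
  have fin: "finite {w. f w \<noteq> 0}"
    using assms by (simp add: free_algebra_simps)
  have "word_pairing f (\<lambda>w. if w = u then 1 else 0) = (\<Sum>w | f w \<noteq> 0. if w = u then f w else 0)"
    unfolding word_pairing_def by (intro sum.cong) auto
  also have "\<dots> = f u"
    using fin by (simp add: sum.delta)
  finally show ?thesis .
qed

text \<open>The indicator functional of a single word reads off its coefficient.\<close>

lemma free_algebra_eqI:
  assumes "f \<in> carrier (free_algebra V)" "g \<in> carrier (free_algebra V)"
    and "\<And>L. word_pairing f L = word_pairing g L"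
  shows "f = g"
proof
  fix w
  show "f w = g w"
    using assms(3)[of "\<lambda>u. if u = w then 1 else 0"] 
    by (simp add: word_pairing_delta[OF assms(1)] word_pairing_delta[OF assms(2)])
qed

lemma free_add_closed:
  assumes "f \<in> carrier (free_algebra V)" "g \<in> carrier (free_algebra V)"
  shows "f \<oplus>\<^bsub>free_algebra V\<^esub> g \<in> carrier (free_algebra V)"
proof -
  have "{w. f w + g w \<noteq> 0} \<subseteq> {w. f w \<noteq> 0} \<union> {w. g w \<noteq> 0}"
    by auto
  then show ?thesis
    using assms unfolding free_algebra_simps by (auto intro: finite_subset)
qed

lemma free_scalar_closed [simp]: "free_scalar c \<in> carrier (free_algebra V)"
proof -
  have "{w. free_scalar c w \<noteq> 0} \<subseteq> {[]}"
    by (auto simp: free_scalar_def)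
  then show ?thesis
    unfolding free_algebra_simps by (auto intro: finite_subset)
qed

lemma free_gen_closed [simp]: "x \<in> V \<Longrightarrow> free_gen x \<in> carrier (free_algebra V)"
  by (auto simp: free_algebra_simps free_gen_def)

lemma ring_free_algebra: "ring (free_algebra V)"
proof (rule ringI)
  let ?F = "free_algebra V"
  show "abelian_group ?F"
  proof (rule abelian_groupI)
    fix f assume "f \<in> carrier ?F"
    then show "\<exists>g\<in>carrier ?F. g \<oplus>\<^bsub>?F\<^esub> f = \<zero>\<^bsub>?F\<^esub>"
      by (intro bexI[of _ "\<lambda>w. - f w"]) (auto simp: free_algebra_simps)
  next
    fix f g assume "f \<in> carrier ?F" "g \<in> carrier ?F"
    then show "f \<oplus>\<^bsub>?F\<^esub> g \<in> carrier ?F"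
      by (rule free_add_closed)
  qed (auto simp: free_algebra_simps algebra_simps)
  show "monoid ?F"
  proof (rule monoidI)
    fix f g h assume "f \<in> carrier ?F" "g \<in> carrier ?F" "h \<in> carrier ?F"
    then show "f \<otimes>\<^bsub>?F\<^esub> g \<otimes>\<^bsub>?F\<^esub> h = f \<otimes>\<^bsub>?F\<^esub> (g \<otimes>\<^bsub>?F\<^esub> h)"
      by (intro free_algebra_eqI[where V = V]) (simp_all add: free_mult_closed word_pairing_mult)
  next
    show "\<one>\<^bsub>?F\<^esub> \<in> carrier ?F"
      by (simp add: free_algebra_simps(3))
  next
    fix f assume f: "f \<in> carrier ?F"
    have one: "\<one>\<^bsub>?F\<^esub> \<in> carrier ?F" "word_pairing (\<one>\<^bsub>?F\<^esub>) L = L []" for L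
      by (simp_all add: free_algebra_simps(3) word_pairing_scalar)
    show "\<one>\<^bsub>?F\<^esub> \<otimes>\<^bsub>?F\<^esub> f = f" "f \<otimes>\<^bsub>?F\<^esub> \<one>\<^bsub>?F\<^esub> = f"
      using f by (auto intro!: free_algebra_eqI[where V = V] simp: one free_mult_closed word_pairing_mult)
  qed (rule free_mult_closed)
next
  let ?F = "free_algebra V"
  fix f g h
  show "(f \<oplus>\<^bsub>?F\<^esub> g) \<otimes>\<^bsub>?F\<^esub> h = f \<otimes>\<^bsub>?F\<^esub> h \<oplus>\<^bsub>?F\<^esub> g \<otimes>\<^bsub>?F\<^esub> h"
    by (auto simp: free_algebra_simps algebra_simps sum.distrib split_def)
  show "h \<otimes>\<^bsub>?F\<^esub> (f \<oplus>\<^bsub>?F\<^esub> g) = h \<otimes>\<^bsub>?F\<^esub> f \<oplus>\<^bsub>?F\<^esub> h \<otimes>\<^bsub>?F\<^esub> g"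
    by (auto simp: free_algebra_simps algebra_simps sum.distrib split_def)
qed

lemma free_uminus:
  assumes "f \<in> carrier (free_algebra V)"
  shows "\<ominus>\<^bsub>free_algebra V\<^esub> f = (\<lambda>w. - f w)"
proof -
  interpret ring "free_algebra V" by (rule ring_free_algebra)
  show ?thesis
    using assms by (intro minus_equality) (auto simp: free_algebra_simps)
qed

lemma word_pairing_minus:
  assumes "f \<in> carrier (free_algebra V)" "g \<in> carrier (free_algebra V)"
  shows "word_pairing (f \<ominus>\<^bsub>free_algebra V\<^esub> g) L = word_pairing f L - word_pairing g L"
proof -
  interpret ring "free_algebra V" by (rule ring_free_algebra)
  have "(\<lambda>w. - g w) \<in> carrier (free_algebra V)"
    using a_inv_closed[OF assms(2)] free_uminus[OF assms(2)] by simp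
  from word_pairing_add[OF assms(1) this] show ?thesis
    using assms by (simp add: a_minus_def free_uminus free_algebra_simps(5) word_pairing_uminus)
qed

lemma free_scalar_mult: "free_scalar a \<otimes>\<^bsub>free_algebra V\<^esub> free_scalar b = free_scalar (a * b)"
  by (intro free_algebra_eqI[where V = V])
    (simp_all add: free_mult_closed word_pairing_mult word_pairing_scalar)

lemma free_scalar_add: "free_scalar a \<oplus>\<^bsub>free_algebra V\<^esub> free_scalar b = free_scalar (a + b)"
  by (auto simp: free_algebra_simps free_scalar_def)

text \<open>A scalar is supported on the empty word, which concatenates trivially on either
  side.\<close>

lemma free_scalar_commute:
  assumes "f \<in> carrier (free_algebra V)"
  shows "free_scalar c \<otimes>\<^bsub>free_algebra V\<^esub> f = f \<otimes>\<^bsub>free_algebra V\<^esub> free_scalar c"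
proof (rule free_algebra_eqI[where V = V])
  show "word_pairing (free_scalar c \<otimes>\<^bsub>free_algebra V\<^esub> f) L
      = word_pairing (f \<otimes>\<^bsub>free_algebra V\<^esub> free_scalar c) L" for L
    using assms by (simp add: word_pairing_mult word_pairing_scalar)
      (simp add: word_pairing_def sum_distrib_left mult_ac)
qed (use assms in \<open>simp_all add: free_mult_closed\<close>)

section \<open>A representation of the Clifford algebra\<close>

text \<open>The symmetric difference of \<open>s\<close> and \<open>{i}\<close>: up to a factor,
  left multiplication by the i-th basis vector sends the monomial of \<open>s\<close> to the
  monomial of this set.\<close>

definition flip :: "'a \<Rightarrow> 'a set \<Rightarrow> 'a set" where
  "flip i s = (if i \<in> s then s - {i} else insert i s)"

text \<open>The Jordan--Wigner sign makes flips of different indices anticommute.\<close>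

definition flip_sign :: "(nat \<Rightarrow> real) \<Rightarrow> nat \<Rightarrow> nat set \<Rightarrow> real" where
  "flip_sign d i s = (-1) ^ card {k \<in> s. k < i} * (if i \<in> s then d i else 1)"

text \<open>If \<open>\<phi>\<close> is read as a linear functional given by its values on
  monomials, this is its value at the monomial of \<open>s\<close> multiplied on the left by the
  vector with coordinates \<open>c\<close>, where \<open>d i\<close> is the square of the i-th basis
  vector. Acting on plain functions presupposes nothing about independence of monomials in the
  Clifford algebra.\<close>

definition flip_action ::
  "nat \<Rightarrow> (nat \<Rightarrow> real) \<Rightarrow> (nat \<Rightarrow> real) \<Rightarrow> (nat set \<Rightarrow> real) \<Rightarrow> nat set \<Rightarrow> real" where
  "flip_action N d c \<phi> s = (\<Sum>i\<in>{1..N}. c i * flip_sign d i s * \<phi> (flip i s))"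

lemma flip_flip: "flip i (flip i s) = s"
  by (auto simp: flip_def)

lemma flip_commute: "flip i (flip j s) = flip j (flip i s)"
  by (auto simp: flip_def)

text \<open>Toggling \<open>i\<close> leaves the indices below \<open>i\<close> alone, so the signs
  cancel; exactly one of \<open>s\<close> and \<open>flip i s\<close> contains \<open>i\<close>,
  which yields a single factor \<open>d i\<close>.\<close>

lemma flip_sign_square: "flip_sign d i s * flip_sign d i (flip i s) = d i"
proof -
  have "{k \<in> flip i s. k < i} = {k \<in> s. k < i}"
    by (auto simp: flip_def)
  then show ?thesis
    by (auto simp: flip_sign_def flip_def)
qed

text \<open>Toggling the larger index \<open>j\<close> does not affect the count below
  \<open>i\<close>, but toggling \<open>i\<close> changes the count below \<open>j\<close> by one.
  This asymmetry is the only source of the minus sign.\<close>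

lemma flip_sign_anticommute_less:
  assumes "i < j"
  shows "flip_sign d i s * flip_sign d j (flip i s) = - (flip_sign d j s * flip_sign d i (flip j s))"
proof -
  have below: "{k \<in> flip j s. k < i} = {k \<in> s. k < i}"
    using assms by (auto simp: flip_def)
  have same: "i \<in> flip j s \<longleftrightarrow> i \<in> s" "j \<in> flip i s \<longleftrightarrow> j \<in> s"
    using assms by (auto simp: flip_def)
  have parity: "(-1) ^ card {k \<in> flip i s. k < j} = - ((-1) ^ card {k \<in> s. k < j} :: real)"
  proof (cases "i \<in> s")
    case True
    then have "{k \<in> s. k < j} = insert i {k \<in> flip i s. k < j}"
      using assms by (auto simp: flip_def)
    moreover have "i \<notin> {k \<in> flip i s. k < j}"
      using True by (auto simp: flip_def)
    ultimately show ?thesis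
      by simp
  next
    case False
    then have "{k \<in> flip i s. k < j} = insert i {k \<in> s. k < j}"
      using assms by (auto simp: flip_def)
    then show ?thesis
      using False by simp
  qed
  show ?thesis
    unfolding flip_sign_def below same parity by simp
qed

lemma flip_sign_anticommute:
  assumes "i \<noteq> j"
  shows "flip_sign d i s * flip_sign d j (flip i s) = - (flip_sign d j s * flip_sign d i (flip j s))"
  using flip_sign_anticommute_less[of i j d s] flip_sign_anticommute_less[of j i d s] assms
  by (cases "i < j") auto

text \<open>Adding the sum to its transpose cancels every off-diagonal pair and doubles the
  diagonal.\<close>

lemma sum_off_diagonal_antisymmetric:
  fixes G :: "'a \<Rightarrow> 'a \<Rightarrow> real"
  assumes "finite A" and anti: "\<And>i j. i \<noteq> j \<Longrightarrow> G i j = - G j i"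
  shows "(\<Sum>i\<in>A. \<Sum>j\<in>A. G i j) = (\<Sum>i\<in>A. G i i)"
proof -
  have "2 * (\<Sum>i\<in>A. \<Sum>j\<in>A. G i j) = (\<Sum>i\<in>A. \<Sum>j\<in>A. G i j) + (\<Sum>i\<in>A. \<Sum>j\<in>A. G j i)"
    using sum.swap[of G A A] by simp
  also have "\<dots> = (\<Sum>i\<in>A. \<Sum>j\<in>A. if i = j then 2 * G i i else 0)"
    unfolding sum.distrib[symmetric]
  proof (intro sum.cong refl)
    show "G i j + G j i = (if i = j then 2 * G i i else 0)" for i j
      using anti[of i j] by (cases "i = j") simp_all
  qed
  also have "\<dots> = 2 * (\<Sum>i\<in>A. G i i)"
    using assms(1) by (simp add: sum_distrib_left)
  finally show ?thesis by simp
qed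

text \<open>The Clifford relation for the operators: mixed terms cancel by anticommutation, and on
  the diagonal the double flip is the identity.\<close>

lemma flip_action_square:
  "flip_action N d c (flip_action N d c \<phi>) s = (\<Sum>i\<in>{1..N}. (c i)\<^sup>2 * d i) * \<phi> s"
proof -
  define G where "G i j = c i * c j * (flip_sign d i s * flip_sign d j (flip i s)) * \<phi> (flip j (flip i s))" for i j
  have "flip_action N d c (flip_action N d c \<phi>) s = (\<Sum>i\<in>{1..N}. \<Sum>j\<in>{1..N}. G i j)"
    by (simp add: flip_action_def G_def sum_distrib_left mult_ac)
  also have "\<dots> = (\<Sum>i\<in>{1..N}. G i i)"
  proof (rule sum_off_diagonal_antisymmetric)
    fix i j :: nat assume "i \<noteq> j"
    then show "G i j = - G j i"
      unfolding G_def flip_sign_anticommute[OF \<open>i \<noteq> j\<close>] flip_commute[of j i] by simp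
  qed simp
  also have "\<dots> = (\<Sum>i\<in>{1..N}. (c i)\<^sup>2 * d i) * \<phi> s"
    by (simp add: G_def flip_sign_square flip_flip power2_eq_square sum_distrib_right)
  finally show ?thesis .
qed

lemma flip_action_linear_combination:
  "flip_action N d c (\<lambda>t. \<Sum>b\<in>B. g b * \<psi> b t) s = (\<Sum>b\<in>B. g b * flip_action N d c (\<psi> b) s)"
  unfolding flip_action_def sum_distrib_left by (subst sum.swap) (simp add: mult_ac)

text \<open>Words act by linear operators; this is what makes the kernel below closed under
  multiplication from the left.\<close>

lemma foldr_flip_action_linear_combination:
  "foldr (\<lambda>x. flip_action N d (co x)) w (\<lambda>t. \<Sum>b\<in>B. g b * \<psi> b t)
     = (\<lambda>s. \<Sum>b\<in>B. g b * foldr (\<lambda>x. flip_action N d (co x)) w (\<psi> b) s)"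
proof (induction w)
  case (Cons x w)
  show ?case
    by (rule ext) (simp add: Cons.IH flip_action_linear_combination)
qed simp

lemma foldr_flip_action_zero: "foldr (\<lambda>x. flip_action N d (co x)) w (\<lambda>t. 0) = (\<lambda>s. 0)"
  by (induction w) (auto simp: flip_action_def)

section \<open>Coordinates and the quadratic form in an orthogonal basis\<close>

locale orthogonal_quadratic_space =
  fixes V :: "'v::real_vector set" and Q :: "'v \<Rightarrow> real" and N :: nat and v :: "nat \<Rightarrow> 'v"
  assumes sub: "subspace V" and quad: "quadratic_form V Q" and basis: "orthogonal_basis V Q N v"
begin

abbreviation F :: "('v list \<Rightarrow> real) ring" where "F \<equiv> free_algebra V"
abbreviation T :: "('v list \<Rightarrow> real) set ring" where "T \<equiv> tensor_algebra V"
abbreviation C :: "('v list \<Rightarrow> real) set set ring" where "C \<equiv> clifford_algebra V Q"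

sublocale F: ring F by (rule ring_free_algebra)

definition coordinates :: "'v \<Rightarrow> nat \<Rightarrow> real" where
  "coordinates x i = representation (v ` {1..N}) x (v i)"

lemma basis_in_V [simp]: "i \<in> {1..N} \<Longrightarrow> v i \<in> V"
  using basis span_base unfolding orthogonal_basis_def by blast

lemma indep: "independent (v ` {1..N})" and span_basis: "span (v ` {1..N}) = V"
  using basis unfolding orthogonal_basis_def by auto

lemma coordinates_add: "x \<in> V \<Longrightarrow> y \<in> V \<Longrightarrow> coordinates (x + y) = (\<lambda>i. coordinates x i + coordinates y i)"
  using indep span_basis by (auto simp: coordinates_def real_vector.representation_add)

lemma coordinates_scaleR: "x \<in> V \<Longrightarrow> coordinates (a *\<^sub>R x) = (\<lambda>i. a * coordinates x i)"
  using indep span_basis by (auto simp: coordinates_def real_vector.representation_scale)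

lemma sum_coordinates:
  assumes "x \<in> V"
  shows "(\<Sum>i\<in>{1..N}. coordinates x i *\<^sub>R v i) = x"
proof -
  have "inj_on v {1..N}"
    using basis by (simp add: orthogonal_basis_def)
  then have "(\<Sum>i\<in>{1..N}. coordinates x i *\<^sub>R v i)
      = (\<Sum>b\<in>v ` {1..N}. representation (v ` {1..N}) x b *\<^sub>R b)"
    by (simp add: sum.reindex coordinates_def)
  also have "\<dots> = x"
    using assms indep span_basis by (intro real_vector.sum_representation_eq) auto
  finally show ?thesis .
qed

lemma Q_zero: "Q 0 = 0"
proof -
  have "0 \<in> V" "\<forall>x\<in>V. \<forall>c. Q (c *\<^sub>R x) = c\<^sup>2 * Q x"
    using sub quad by (auto simp: subspace_0 quadratic_form_def)
  then have "Q (0 *\<^sub>R 0) = 0\<^sup>2 * Q 0"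
    by blast
  then show ?thesis by simp
qed

lemma combination_in_V: "A \<subseteq> {1..N} \<Longrightarrow> (\<Sum>i\<in>A. c i *\<^sub>R v i) \<in> V"
  using sub by (intro subspace_sum subspace_scale) auto

lemma polar_form_combination:
  assumes "z \<in> V" "A \<subseteq> {1..N}"
  shows "polar_form Q (\<Sum>i\<in>A. c i *\<^sub>R v i) z = (\<Sum>i\<in>A. c i * polar_form Q (v i) z)"
proof -
  have "finite A"
    using assms(2) finite_subset by auto
  then show ?thesis
    using assms(2)
  proof (induction A rule: finite_induct)
    case empty
    then show ?case
      by (simp add: polar_form_def Q_zero)
  next
    case (insert a A)
    then have a: "v a \<in> V" "c a *\<^sub>R v a \<in> V"
      using subspace_scale[OF sub, of "v a"] by auto
    have "polar_form Q (c a *\<^sub>R v a + (\<Sum>i\<in>A. c i *\<^sub>R v i)) z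
        = polar_form Q (c a *\<^sub>R v a) z + polar_form Q (\<Sum>i\<in>A. c i *\<^sub>R v i) z"
      using quad a assms(1) combination_in_V[of A c] insert.prems by (auto simp: quadratic_form_def)
    moreover have "polar_form Q (c a *\<^sub>R v a) z = c a * polar_form Q (v a) z"
      using quad a assms(1) by (auto simp: quadratic_form_def)
    ultimately show ?case
      using insert by simp
  qed
qed

text \<open>When one term is added to a combination, \<open>Q\<close> of the sum exceeds the sum of
  the \<open>Q\<close> values by a polar form, which vanishes by orthogonality.\<close>

lemma Q_combination:
  assumes "A \<subseteq> {1..N}"
  shows "Q (\<Sum>i\<in>A. c i *\<^sub>R v i) = (\<Sum>i\<in>A. (c i)\<^sup>2 * Q (v i))"
proof -
  have "finite A"
    using assms finite_subset by auto
  then show ?thesis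
    using assms
  proof (induction A rule: finite_induct)
    case (insert a A)
    let ?y = "\<Sum>i\<in>A. c i *\<^sub>R v i"
    have mem: "?y \<in> V" "v a \<in> V" "a \<in> {1..N}"
      using combination_in_V[of A c] insert.prems by auto
    \<comment> \<open>Symmetry moves the combination into the first argument, where linearity is
      available.\<close>
    have "polar_form Q (v a) ?y = polar_form Q ?y (v a)"
      by (simp add: polar_form_def add.commute)
    also have "\<dots> = (\<Sum>i\<in>A. c i * polar_form Q (v i) (v a))"
      using insert.prems mem by (intro polar_form_combination) auto
    also have "\<dots> = 0"
    proof (intro sum.neutral ballI)
      fix i assume "i \<in> A"
      then have "i \<in> {1..N}" "i \<noteq> a"
        using insert by auto
      then show "c i * polar_form Q (v i) (v a) = 0"
        using basis mem by (simp add: orthogonal_basis_def)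
    qed
    finally have "polar_form Q (c a *\<^sub>R v a) ?y = 0"
      using quad mem by (simp add: quadratic_form_def)
    moreover have "Q (c a *\<^sub>R v a) = (c a)\<^sup>2 * Q (v a)"
      using quad mem by (simp add: quadratic_form_def)
    ultimately show ?case
      using insert by (simp add: polar_form_def)
  qed (simp add: Q_zero)
qed

lemma Q_eq_sum_coordinates: "x \<in> V \<Longrightarrow> Q x = (\<Sum>i\<in>{1..N}. (coordinates x i)\<^sup>2 * Q (v i))"
  using Q_combination[of "{1..N}" "coordinates x"] sum_coordinates by simp

section \<open>The kernel of the representation\<close>

abbreviation vec_action :: "'v \<Rightarrow> (nat set \<Rightarrow> real) \<Rightarrow> nat set \<Rightarrow> real" where
  "vec_action x \<equiv> flip_action N (\<lambda>i. Q (v i)) (coordinates x)"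

text \<open>The pairing is the value at \<open>s\<close> of the action of \<open>f\<close> on
  \<open>\<phi>\<close>, so these are the elements acting as the zero operator.\<close>

definition representation_kernel :: "('v list \<Rightarrow> real) set" where
  "representation_kernel =
     {f \<in> carrier F. \<forall>\<phi> s. word_pairing f (\<lambda>w. foldr vec_action w \<phi> s) = 0}"

lemma ideal_representation_kernel: "ideal representation_kernel F"
proof (rule idealI)
  show "subgroup representation_kernel (add_monoid F)"
  proof (rule F.add.subgroupI)
    show "representation_kernel \<noteq> {}"
      using F.zero_closed by (auto simp: representation_kernel_def free_algebra_simps(4) word_pairing_def)
    fix f assume "f \<in> representation_kernel"
    then show "\<ominus>\<^bsub>F\<^esub> f \<in> representation_kernel"
      using F.a_inv_closed[of f] by (simp add: representation_kernel_def free_uminus word_pairing_uminus)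
    fix g assume "g \<in> representation_kernel"
    then show "f \<oplus>\<^bsub>F\<^esub> g \<in> representation_kernel"
      using \<open>f \<in> representation_kernel\<close> F.a_closed[of f g] word_pairing_add[of f V g]
      by (auto simp: representation_kernel_def free_algebra_simps(5))
  qed (auto simp: representation_kernel_def)
next
  fix f g assume f: "f \<in> representation_kernel" and g: "g \<in> carrier F"
  then have carr: "f \<in> carrier F"
    by (simp add: representation_kernel_def)
  have zero: "(\<lambda>s. \<Sum>b | f b \<noteq> 0. f b * foldr vec_action b \<phi> s) = (\<lambda>s. 0)" for \<phi>
    using f by (auto simp: representation_kernel_def word_pairing_def)
  \<comment> \<open>For left multiples: the linear operator of the word \<open>a\<close> is applied
    to the zero function.\<close>
  have "word_pairing f (\<lambda>b. foldr vec_action a (foldr vec_action b \<phi>) s) = 0" for a \<phi> s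
    using foldr_flip_action_linear_combination[of N "\<lambda>i. Q (v i)" coordinates a f
        "\<lambda>b. foldr vec_action b \<phi>" "{b. f b \<noteq> 0}"]
    unfolding zero foldr_flip_action_zero word_pairing_def by metis
  then show "g \<otimes>\<^bsub>F\<^esub> f \<in> representation_kernel"
    using g carr by (simp add: representation_kernel_def word_pairing_mult) (simp add: word_pairing_def)
  \<comment> \<open>For right multiples: after exchanging the sums, \<open>f\<close> acts on the
    functions \<open>foldr vec_action b \<phi>\<close> and annihilates each of them.\<close>
  have "word_pairing (f \<otimes>\<^bsub>F\<^esub> g) (\<lambda>w. foldr vec_action w \<phi> s) = 0" for \<phi> s
  proof -
    have "word_pairing (f \<otimes>\<^bsub>F\<^esub> g) (\<lambda>w. foldr vec_action w \<phi> s)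
        = (\<Sum>a | f a \<noteq> 0. \<Sum>b | g b \<noteq> 0. f a * (g b * foldr vec_action a (foldr vec_action b \<phi>) s))"
      using g carr by (simp add: word_pairing_mult) (simp add: word_pairing_def sum_distrib_left)
    also have "\<dots> = (\<Sum>b | g b \<noteq> 0. g b * word_pairing f (\<lambda>a. foldr vec_action a (foldr vec_action b \<phi>) s))"
      by (subst sum.swap) (simp add: word_pairing_def sum_distrib_left mult_ac)
    also have "\<dots> = 0"
      using f by (simp add: representation_kernel_def)
    finally show ?thesis .
  qed
  then show "f \<otimes>\<^bsub>F\<^esub> g \<in> representation_kernel"
    using g carr by (simp add: representation_kernel_def)
qed (rule ring_free_algebra)

lemma tensor_relations_in_kernel:
  "x \<in> V \<Longrightarrow> y \<in> V \<Longrightarrow> free_gen (x + y) \<ominus>\<^bsub>F\<^esub> (free_gen x \<oplus>\<^bsub>F\<^esub> free_gen y) \<in> representation_kernel"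
  "x \<in> V \<Longrightarrow> free_gen (c *\<^sub>R x) \<ominus>\<^bsub>F\<^esub> (free_scalar c \<otimes>\<^bsub>F\<^esub> free_gen x) \<in> representation_kernel"
proof -
  assume x: "x \<in> V"
  then show "free_gen (c *\<^sub>R x) \<ominus>\<^bsub>F\<^esub> (free_scalar c \<otimes>\<^bsub>F\<^esub> free_gen x) \<in> representation_kernel"
    using subspace_scale[OF sub x, of c]
    by (auto simp: representation_kernel_def word_pairing_minus word_pairing_gen word_pairing_mult
        word_pairing_scalar coordinates_scaleR flip_action_def sum_distrib_left mult_ac)
  assume y: "y \<in> V"
  have "word_pairing (free_gen x \<oplus>\<^bsub>F\<^esub> free_gen y) L = L [x] + L [y]" for L
    using x y word_pairing_add[of "free_gen x" V "free_gen y"] by (simp add: free_algebra_simps(5) word_pairing_gen)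
  then show "free_gen (x + y) \<ominus>\<^bsub>F\<^esub> (free_gen x \<oplus>\<^bsub>F\<^esub> free_gen y) \<in> representation_kernel"
    using x y subspace_add[OF sub x y]
    by (auto simp: representation_kernel_def word_pairing_minus word_pairing_gen
        coordinates_add flip_action_def sum.distrib algebra_simps)
qed

lemma clifford_relation_in_kernel:
  assumes "x \<in> V"
  shows "free_gen x \<otimes>\<^bsub>F\<^esub> free_gen x \<ominus>\<^bsub>F\<^esub> free_scalar (Q x) \<in> representation_kernel"
proof -
  have "vec_action x (vec_action x \<phi>) s = Q x * \<phi> s" for \<phi> s
    by (simp only: flip_action_square Q_eq_sum_coordinates[OF assms])
  then show ?thesis
    using assms by (simp add: representation_kernel_def free_mult_closed word_pairing_minus
        word_pairing_gen word_pairing_mult word_pairing_scalar)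
qed

text \<open>A scalar acts by multiplication, so the constant function 1 detects it.\<close>

lemma free_scalar_in_kernel: "free_scalar c \<in> representation_kernel \<Longrightarrow> c = 0"
  unfolding representation_kernel_def by (auto simp: word_pairing_scalar dest: spec[of _ "\<lambda>_. 1"])

end

section \<open>Squares of monomials\<close>

lemma monomial_degree_bij: "bij_betw (monomial_degree N) (Pow {1..N}) (Z2_power N)"
proof (rule bij_betw_byWitness[where f' = "\<lambda>t. {i \<in> {1..N}. t i = 1}"])
  show "\<forall>I\<in>Pow {1..N}. {i \<in> {1..N}. monomial_degree N I i = 1} = I"
    by (auto simp: monomial_degree_def)
  show "\<forall>t\<in>Z2_power N. monomial_degree N {i \<in> {1..N}. t i = 1} = t"
  proof (intro ballI ext)
    fix t i assume "t \<in> Z2_power N"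
    \<comment> \<open>Inside the index range a bit other than 1 is 0; outside it both functions take
      the default value of an extensional function.\<close>
    then show "monomial_degree N {i \<in> {1..N}. t i = 1} i = t i"
      using bit_not_one_iff[of "t i"] PiE_arb[of t "{1..N}" "\<lambda>_. UNIV" i]
      by (cases "i \<in> {1..N}") (simp_all add: Z2_power_def monomial_degree_def)
  qed
qed (auto simp: Z2_power_def monomial_degree_def)

lemma Arf_eq_sgn_sum:
  assumes "finite T" and \<mu>: "\<And>t. t \<in> T \<Longrightarrow> \<mu> t \<in> {1, -1}"
  shows "Arf T \<mu> = sgn (\<Sum>t\<in>T. \<mu> t)"
proof -
  have "T = {t \<in> T. \<mu> t = 1} \<union> {t \<in> T. \<mu> t = -1}"
    using \<mu> by auto
  then have "(\<Sum>t\<in>T. \<mu> t) = (\<Sum>t\<in>{t \<in> T. \<mu> t = 1} \<union> {t \<in> T. \<mu> t = -1}. \<mu> t)"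
    by simp
  also have "\<dots> = (\<Sum>t | t \<in> T \<and> \<mu> t = 1. \<mu> t) + (\<Sum>t | t \<in> T \<and> \<mu> t = -1. \<mu> t)"
    using assms(1) by (intro sum.union_disjoint) auto
  also have "\<dots> = real (card {t \<in> T. \<mu> t = 1}) - real (card {t \<in> T. \<mu> t = -1})"
    by simp
  finally show ?thesis
    by (simp add: Arf_def)
qed

section \<open>The tensor and Clifford algebras as quotients\<close>

context orthogonal_quadratic_space
begin

text \<open>The upper bound holds by minimality of the generated ideal: the kernel is an ideal
  containing the linearity relations.\<close>

lemma ideal_tensor_ideal: "ideal (tensor_ideal V) F"
  and tensor_additivity:
    "x \<in> V \<Longrightarrow> y \<in> V \<Longrightarrow> free_gen (x + y) \<ominus>\<^bsub>F\<^esub> (free_gen x \<oplus>\<^bsub>F\<^esub> free_gen y) \<in> tensor_ideal V"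
  and tensor_ideal_subset: "tensor_ideal V \<subseteq> representation_kernel"
proof -
  let ?S = "{free_gen (x + y) \<ominus>\<^bsub>F\<^esub> (free_gen x \<oplus>\<^bsub>F\<^esub> free_gen y) | x y. x \<in> V \<and> y \<in> V} \<union>
       {free_gen (c *\<^sub>R x) \<ominus>\<^bsub>F\<^esub> (free_scalar c \<otimes>\<^bsub>F\<^esub> free_gen x) | c x. x \<in> V}"
  have S: "?S \<subseteq> representation_kernel"
    using tensor_relations_in_kernel by blast
  also have "representation_kernel \<subseteq> carrier F"
    by (auto simp: representation_kernel_def)
  finally have S_carrier: "?S \<subseteq> carrier F" .
  show "ideal (tensor_ideal V) F"
    unfolding tensor_ideal_def Let_def by (rule F.genideal_ideal[OF S_carrier])
  show "x \<in> V \<Longrightarrow> y \<in> V \<Longrightarrow> free_gen (x + y) \<ominus>\<^bsub>F\<^esub> (free_gen x \<oplus>\<^bsub>F\<^esub> free_gen y) \<in> tensor_ideal V"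
    unfolding tensor_ideal_def Let_def using F.genideal_self[OF S_carrier] by blast
  show "tensor_ideal V \<subseteq> representation_kernel"
    unfolding tensor_ideal_def Let_def by (rule F.genideal_minimal[OF ideal_representation_kernel S])
qed

sublocale T: ring T
  unfolding tensor_algebra_def by (rule ideal.quotient_is_ring[OF ideal_tensor_ideal])

sublocale FT: ring_hom_ring F T "(+>\<^bsub>F\<^esub>) (tensor_ideal V)"
  unfolding tensor_algebra_def by (rule ideal.rcos_ring_hom_ring[OF ideal_tensor_ideal])

lemma tensor_hom_minus:
  assumes "f \<in> carrier F" "g \<in> carrier F"
  shows "(tensor_ideal V +>\<^bsub>F\<^esub> f) \<ominus>\<^bsub>T\<^esub> (tensor_ideal V +>\<^bsub>F\<^esub> g) = tensor_ideal V +>\<^bsub>F\<^esub> (f \<ominus>\<^bsub>F\<^esub> g)"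
  using assms by (simp add: a_minus_def)

lemma clifford_relation:
  assumes "x \<in> V"
  shows "(tensor_vec V x \<otimes>\<^bsub>T\<^esub> tensor_vec V x) \<ominus>\<^bsub>T\<^esub> tensor_scalar V (Q x)
     = tensor_ideal V +>\<^bsub>F\<^esub> (free_gen x \<otimes>\<^bsub>F\<^esub> free_gen x \<ominus>\<^bsub>F\<^esub> free_scalar (Q x))"
  using assms by (simp add: tensor_vec_def tensor_scalar_def flip: tensor_hom_minus)

lemma tensor_scalar_closed [simp]: "tensor_scalar V c \<in> carrier T"
  unfolding tensor_scalar_def by simp

lemma tensor_vec_closed [simp]: "x \<in> V \<Longrightarrow> tensor_vec V x \<in> carrier T"
  unfolding tensor_vec_def by simp

text \<open>The image of the kernel in the tensor algebra is again an ideal and contains the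
  Clifford relations. This bounds the Clifford ideal without carrying the operators over to the
  quotient.\<close>

lemma ideal_clifford_ideal: "ideal (clifford_ideal V Q) T"
  and clifford_relation_mem:
    "x \<in> V \<Longrightarrow> (tensor_vec V x \<otimes>\<^bsub>T\<^esub> tensor_vec V x) \<ominus>\<^bsub>T\<^esub> tensor_scalar V (Q x) \<in> clifford_ideal V Q"
  and clifford_ideal_subset: "clifford_ideal V Q \<subseteq> (+>\<^bsub>F\<^esub>) (tensor_ideal V) ` representation_kernel"
proof -
  let ?S = "{(tensor_vec V x \<otimes>\<^bsub>T\<^esub> tensor_vec V x) \<ominus>\<^bsub>T\<^esub> tensor_scalar V (Q x) | x. x \<in> V}"
  have S: "?S \<subseteq> carrier T"
    by auto
  show "ideal (clifford_ideal V Q) T"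
    unfolding clifford_ideal_def Let_def by (rule T.genideal_ideal[OF S])
  show "x \<in> V \<Longrightarrow> (tensor_vec V x \<otimes>\<^bsub>T\<^esub> tensor_vec V x) \<ominus>\<^bsub>T\<^esub> tensor_scalar V (Q x) \<in> clifford_ideal V Q"
    unfolding clifford_ideal_def Let_def using T.genideal_self[OF S] by blast
  have "ideal ((+>\<^bsub>F\<^esub>) (tensor_ideal V) ` representation_kernel) T"
    unfolding tensor_algebra_def
    by (rule F.ring_ideal_imp_quot_ideal[OF ideal_tensor_ideal ideal_representation_kernel])
  moreover have "?S \<subseteq> (+>\<^bsub>F\<^esub>) (tensor_ideal V) ` representation_kernel"
    using clifford_relation clifford_relation_in_kernel by auto
  ultimately show "clifford_ideal V Q \<subseteq> (+>\<^bsub>F\<^esub>) (tensor_ideal V) ` representation_kernel"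
    unfolding clifford_ideal_def Let_def by (rule T.genideal_minimal)
qed

sublocale C: ring C
  unfolding clifford_algebra_def by (rule ideal.quotient_is_ring[OF ideal_clifford_ideal])

sublocale TC: ring_hom_ring T C "(+>\<^bsub>T\<^esub>) (clifford_ideal V Q)"
  unfolding clifford_algebra_def by (rule ideal.rcos_ring_hom_ring[OF ideal_clifford_ideal])

section \<open>Scalars and vectors in the Clifford algebra\<close>

abbreviation clifford_class :: "('v list \<Rightarrow> real) \<Rightarrow> ('v list \<Rightarrow> real) set set" where
  "clifford_class f \<equiv> clifford_ideal V Q +>\<^bsub>T\<^esub> (tensor_ideal V +>\<^bsub>F\<^esub> f)"

abbreviation sc :: "real \<Rightarrow> ('v list \<Rightarrow> real) set set" where "sc \<equiv> clifford_scalar V Q"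
abbreviation cv :: "'v \<Rightarrow> ('v list \<Rightarrow> real) set set" where "cv \<equiv> clifford_vec V Q"

lemma sc_eq_class: "sc c = clifford_class (free_scalar c)"
  by (simp add: clifford_scalar_def tensor_scalar_def)

lemma cv_eq_class: "cv x = clifford_class (free_gen x)"
  by (simp add: clifford_vec_def tensor_vec_def)

lemma sc_closed [simp]: "sc c \<in> carrier C"
  by (simp add: sc_eq_class)

lemma cv_closed [simp]: "x \<in> V \<Longrightarrow> cv x \<in> carrier C"
  by (simp add: cv_eq_class)

lemma sc_mult: "sc a \<otimes>\<^bsub>C\<^esub> sc b = sc (a * b)"
  by (simp add: sc_eq_class free_scalar_mult flip: TC.hom_mult FT.hom_mult)

lemma sc_add: "sc a \<oplus>\<^bsub>C\<^esub> sc b = sc (a + b)"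
  by (simp add: sc_eq_class free_scalar_add flip: TC.hom_add FT.hom_add)

lemma sc_one: "sc 1 = \<one>\<^bsub>C\<^esub>"
  by (simp add: sc_eq_class flip: free_algebra_simps(3)[of V])

lemma sc_zero: "sc 0 = \<zero>\<^bsub>C\<^esub>"
proof -
  have "sc 0 \<oplus>\<^bsub>C\<^esub> sc 0 = sc 0"
    by (simp add: sc_add)
  then show ?thesis
    using C.add.r_cancel_one[of "sc 0" "sc 0"] by simp
qed

lemma sc_uminus_one: "sc (-1) = \<ominus>\<^bsub>C\<^esub> \<one>\<^bsub>C\<^esub>"
  using sc_add[of "-1" 1] by (intro C.minus_equality[symmetric]) (simp_all add: sc_zero sc_one)

lemma sc_commute:
  assumes "X \<in> carrier C"
  shows "X \<otimes>\<^bsub>C\<^esub> sc c = sc c \<otimes>\<^bsub>C\<^esub> X"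
proof -
  \<comment> \<open>Centrality is checked on a representative lifted through both quotients to the
    free algebra.\<close>
  obtain Y where "Y \<in> carrier T" "X = clifford_ideal V Q +>\<^bsub>T\<^esub> Y"
    using assms unfolding clifford_algebra_def FactRing_def A_RCOSETS_def' by auto
  moreover then obtain f where "f \<in> carrier F" "Y = tensor_ideal V +>\<^bsub>F\<^esub> f"
    unfolding tensor_algebra_def FactRing_def A_RCOSETS_def' by auto
  ultimately show ?thesis
    by (simp add: sc_eq_class free_scalar_commute flip: TC.hom_mult FT.hom_mult)
qed

text \<open>If two scalars coincided, their difference would act as zero under the representation,
  hence be zero. In particular 1 and -1 stay distinct.\<close>

lemma sc_inject: "sc a = sc b \<longleftrightarrow> a = b"
proof
  assume "sc a = sc b"
  then have "tensor_scalar V a \<ominus>\<^bsub>T\<^esub> tensor_scalar V b \<in> clifford_ideal V Q"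
    using T.quotient_eq_iff_same_a_r_cos[OF ideal_clifford_ideal, of "tensor_scalar V a" "tensor_scalar V b"]
    by (simp add: clifford_scalar_def)
  moreover have "free_scalar a \<ominus>\<^bsub>F\<^esub> free_scalar b = free_scalar (a - b)"
    by (rule free_algebra_eqI[where V = V])
      (simp_all add: word_pairing_minus word_pairing_scalar algebra_simps)
  ultimately have "tensor_ideal V +>\<^bsub>F\<^esub> free_scalar (a - b) \<in> (+>\<^bsub>F\<^esub>) (tensor_ideal V) ` representation_kernel"
    using clifford_ideal_subset by (auto simp: tensor_scalar_def tensor_hom_minus)
  then obtain k where k: "k \<in> representation_kernel"
    and eq: "tensor_ideal V +>\<^bsub>F\<^esub> free_scalar (a - b) = tensor_ideal V +>\<^bsub>F\<^esub> k"
    by auto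
  have k_carrier: "k \<in> carrier F"
    using k by (simp add: representation_kernel_def)
  \<comment> \<open>Equality of classes holds only up to the tensor ideal, but that ideal also lies
    in the kernel.\<close>
  then have "free_scalar (a - b) \<ominus>\<^bsub>F\<^esub> k \<in> representation_kernel"
    using F.quotient_eq_iff_same_a_r_cos[OF ideal_tensor_ideal, of "free_scalar (a - b)" k] eq
      tensor_ideal_subset by auto
  then have "free_scalar (a - b) \<in> representation_kernel"
    using k k_carrier by (simp add: representation_kernel_def word_pairing_minus)
  then show "a = b"
    using free_scalar_in_kernel[of "a - b"] by simp
qed simp

lemma cv_square:
  assumes "x \<in> V"
  shows "cv x \<otimes>\<^bsub>C\<^esub> cv x = sc (Q x)"
proof -
  have "clifford_ideal V Q +>\<^bsub>T\<^esub> (tensor_vec V x \<otimes>\<^bsub>T\<^esub> tensor_vec V x)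
      = clifford_ideal V Q +>\<^bsub>T\<^esub> tensor_scalar V (Q x)"
    using T.quotient_eq_iff_same_a_r_cos[OF ideal_clifford_ideal,
        of "tensor_vec V x \<otimes>\<^bsub>T\<^esub> tensor_vec V x" "tensor_scalar V (Q x)"]
      clifford_relation_mem[OF assms] assms by simp
  then show ?thesis
    using assms by (simp add: clifford_vec_def clifford_scalar_def)
qed

lemma cv_add:
  assumes "x \<in> V" "y \<in> V"
  shows "cv (x + y) = cv x \<oplus>\<^bsub>C\<^esub> cv y"
proof -
  have mem: "x + y \<in> V"
    using assms sub by (simp add: subspace_add)
  have "free_gen (x + y) \<ominus>\<^bsub>F\<^esub> (free_gen x \<oplus>\<^bsub>F\<^esub> free_gen y) \<in> tensor_ideal V"
    using assms by (rule tensor_additivity)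
  then have "tensor_ideal V +>\<^bsub>F\<^esub> free_gen (x + y) = tensor_ideal V +>\<^bsub>F\<^esub> (free_gen x \<oplus>\<^bsub>F\<^esub> free_gen y)"
    using F.quotient_eq_iff_same_a_r_cos[OF ideal_tensor_ideal, of "free_gen (x + y)" "free_gen x \<oplus>\<^bsub>F\<^esub> free_gen y"]
      assms mem by simp
  then show ?thesis
    using assms by (simp add: cv_eq_class)
qed

text \<open>Polarization: the square of the class of \<open>x + y\<close> is computed once as the
  scalar \<open>Q x + Q y\<close> and once by distributivity, so the two mixed products add up to
  zero.\<close>

lemma cv_anticommute:
  assumes "x \<in> V" "y \<in> V" "polar_form Q x y = 0"
  shows "cv x \<otimes>\<^bsub>C\<^esub> cv y = sc (-1) \<otimes>\<^bsub>C\<^esub> (cv y \<otimes>\<^bsub>C\<^esub> cv x)"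
proof -
  let ?a = "cv x" and ?b = "cv y"
  have Q_add: "Q (x + y) = Q x + Q y"
    using assms(3) by (simp add: polar_form_def)
  have "?a \<otimes>\<^bsub>C\<^esub> ?a \<oplus>\<^bsub>C\<^esub> ?b \<otimes>\<^bsub>C\<^esub> ?b = sc (Q (x + y))"
    using assms by (simp add: cv_square sc_add Q_add)
  also have "\<dots> = cv (x + y) \<otimes>\<^bsub>C\<^esub> cv (x + y)"
    using assms sub by (simp add: cv_square subspace_add)
  also have "\<dots> = (?a \<otimes>\<^bsub>C\<^esub> ?a \<oplus>\<^bsub>C\<^esub> ?b \<otimes>\<^bsub>C\<^esub> ?b) \<oplus>\<^bsub>C\<^esub> (?a \<otimes>\<^bsub>C\<^esub> ?b \<oplus>\<^bsub>C\<^esub> ?b \<otimes>\<^bsub>C\<^esub> ?a)"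
    using assms by (simp add: cv_add C.l_distr C.r_distr C.a_ac)
  finally have "?a \<otimes>\<^bsub>C\<^esub> ?b \<oplus>\<^bsub>C\<^esub> ?b \<otimes>\<^bsub>C\<^esub> ?a = \<zero>\<^bsub>C\<^esub>"
    using assms
      C.add.r_cancel_one'[of "?a \<otimes>\<^bsub>C\<^esub> ?b \<oplus>\<^bsub>C\<^esub> ?b \<otimes>\<^bsub>C\<^esub> ?a" "?a \<otimes>\<^bsub>C\<^esub> ?a \<oplus>\<^bsub>C\<^esub> ?b \<otimes>\<^bsub>C\<^esub> ?b"]
    by simp
  then have "?a \<otimes>\<^bsub>C\<^esub> ?b = \<ominus>\<^bsub>C\<^esub> (?b \<otimes>\<^bsub>C\<^esub> ?a)"
    using assms by (intro C.minus_equality[symmetric]) simp_all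
  then show ?thesis
    using assms by (simp add: sc_uminus_one C.l_minus)
qed

text \<open>Arbitrary index lists, rather than sorted lists of sets, permit induction on the
  list.\<close>

definition list_monomial :: "nat list \<Rightarrow> ('v list \<Rightarrow> real) set set" where
  "list_monomial is = foldr (\<lambda>i a. cv (v i) \<otimes>\<^bsub>C\<^esub> a) is \<one>\<^bsub>C\<^esub>"

lemma list_monomial_simps [simp]:
  "list_monomial [] = \<one>\<^bsub>C\<^esub>"
  "list_monomial (i # is) = cv (v i) \<otimes>\<^bsub>C\<^esub> list_monomial is"
  by (simp_all add: list_monomial_def)

lemma list_monomial_closed [simp]: "set is \<subseteq> {1..N} \<Longrightarrow> list_monomial is \<in> carrier C"
  by (induction "is") simp_all

lemma sc_left_commute:
  assumes "X \<in> carrier C" "Y \<in> carrier C"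
  shows "X \<otimes>\<^bsub>C\<^esub> (sc c \<otimes>\<^bsub>C\<^esub> Y) = sc c \<otimes>\<^bsub>C\<^esub> (X \<otimes>\<^bsub>C\<^esub> Y)"
  using assms sc_commute[OF assms(1)] by (simp flip: C.m_assoc)

lemma sc_mult_left: "X \<in> carrier C \<Longrightarrow> sc a \<otimes>\<^bsub>C\<^esub> (sc b \<otimes>\<^bsub>C\<^esub> X) = sc (a * b) \<otimes>\<^bsub>C\<^esub> X"
  by (simp add: sc_mult flip: C.m_assoc)

text \<open>Moving the factor to the front passes every entry of the list once, at the cost of a
  sign each time.\<close>

lemma list_monomial_anticommute:
  assumes "set is \<subseteq> {1..N}" "i \<in> {1..N}" "i \<notin> set is"
  shows "list_monomial is \<otimes>\<^bsub>C\<^esub> cv (v i)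
           = sc ((-1) ^ length is) \<otimes>\<^bsub>C\<^esub> (cv (v i) \<otimes>\<^bsub>C\<^esub> list_monomial is)"
  using assms
proof (induction "is")
  case Nil
  then show ?case
    by (simp add: sc_one)
next
  case (Cons j js)
  let ?a = "cv (v i)" and ?b = "cv (v j)" and ?m = "list_monomial js"
  have closed: "?a \<in> carrier C" "?b \<in> carrier C" "?m \<in> carrier C"
    using Cons.prems by simp_all
  have "j \<in> {1..N}" "j \<noteq> i"
    using Cons.prems by auto
  then have "polar_form Q (v j) (v i) = 0"
    using Cons.prems(2) basis unfolding orthogonal_basis_def by blast
  then have anti: "?b \<otimes>\<^bsub>C\<^esub> ?a = sc (-1) \<otimes>\<^bsub>C\<^esub> (?a \<otimes>\<^bsub>C\<^esub> ?b)"
    using Cons.prems by (intro cv_anticommute) simp_all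
  have "list_monomial (j # js) \<otimes>\<^bsub>C\<^esub> ?a = ?b \<otimes>\<^bsub>C\<^esub> (?m \<otimes>\<^bsub>C\<^esub> ?a)"
    using closed by (simp add: C.m_assoc)
  also have "?m \<otimes>\<^bsub>C\<^esub> ?a = sc ((-1) ^ length js) \<otimes>\<^bsub>C\<^esub> (?a \<otimes>\<^bsub>C\<^esub> ?m)"
    using Cons.prems by (intro Cons.IH) simp_all
  also have "?b \<otimes>\<^bsub>C\<^esub> \<dots> = sc ((-1) ^ length js) \<otimes>\<^bsub>C\<^esub> ((?b \<otimes>\<^bsub>C\<^esub> ?a) \<otimes>\<^bsub>C\<^esub> ?m)"
    using closed by (simp add: sc_left_commute C.m_assoc)
  also have "\<dots> = sc ((-1) ^ length (j # js)) \<otimes>\<^bsub>C\<^esub> (?a \<otimes>\<^bsub>C\<^esub> list_monomial (j # js))"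
    unfolding anti using closed by (simp add: C.m_assoc sc_mult_left)
  finally show ?case .
qed

text \<open>The head of the second copy passes the tail of the first, giving
  \<open>length js\<close> signs, and then meets its own twin. The exponents add up by Pascal's
  rule: \<open>length js\<close> plus \<open>length js choose 2\<close> is
  \<open>Suc (length js) choose 2\<close>.\<close>

lemma list_monomial_square:
  assumes "set is \<subseteq> {1..N}" "distinct is"
  shows "list_monomial is \<otimes>\<^bsub>C\<^esub> list_monomial is
           = sc ((-1) ^ (length is choose 2) * (\<Prod>i\<leftarrow>is. Q (v i)))"
  using assms
proof (induction "is")
  case Nil
  then show ?case
    by (simp add: sc_one numeral_2_eq_2)
next
  case (Cons i js)
  let ?a = "cv (v i)" and ?m = "list_monomial js"
  have closed: "?a \<in> carrier C" "?m \<in> carrier C" and i: "v i \<in> V"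
    using Cons.prems by simp_all
  have "list_monomial (i # js) \<otimes>\<^bsub>C\<^esub> list_monomial (i # js) = ?a \<otimes>\<^bsub>C\<^esub> ((?m \<otimes>\<^bsub>C\<^esub> ?a) \<otimes>\<^bsub>C\<^esub> ?m)"
    using closed by (simp add: C.m_assoc)
  also have "?m \<otimes>\<^bsub>C\<^esub> ?a = sc ((-1) ^ length js) \<otimes>\<^bsub>C\<^esub> (?a \<otimes>\<^bsub>C\<^esub> ?m)"
    using Cons.prems by (intro list_monomial_anticommute) simp_all
  also have "?a \<otimes>\<^bsub>C\<^esub> (\<dots> \<otimes>\<^bsub>C\<^esub> ?m)
      = sc ((-1) ^ length js) \<otimes>\<^bsub>C\<^esub> ((?a \<otimes>\<^bsub>C\<^esub> ?a) \<otimes>\<^bsub>C\<^esub> (?m \<otimes>\<^bsub>C\<^esub> ?m))"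
    using closed by (simp add: sc_left_commute C.m_assoc)
  also have "\<dots> = sc ((-1) ^ (length (i # js) choose 2) * (\<Prod>i\<leftarrow>i # js. Q (v i)))"
    using Cons by (simp add: cv_square[OF i] sc_mult numeral_2_eq_2 power_add mult_ac)
  finally show ?case .
qed

lemma clifford_monomial_square:
  assumes "I \<subseteq> {1..N}"
  shows "clifford_monomial V Q v I \<otimes>\<^bsub>C\<^esub> clifford_monomial V Q v I
           = sc ((-1) ^ (card I choose 2) * (\<Prod>i\<in>I. Q (v i)))"
proof -
  have "finite I"
    using assms finite_subset by auto
  then show ?thesis
    using list_monomial_square[of "sorted_list_of_set I"] assms
    by (simp add: clifford_monomial_def list_monomial_def prod.distinct_set_conv_list[symmetric])
qed

text \<open>The definite description is justified here: the formula for the square supplies a value,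
  and injectivity of the scalars makes it unique.\<close>

lemma clifford_mu_eq:
  assumes I: "I \<subseteq> {1..N}" and Q: "\<And>i. i \<in> {1..N} \<Longrightarrow> Q (v i) \<in> {1, -1}"
  shows "clifford_mu V Q N v (monomial_degree N I) = (-1) ^ (card I choose 2) * (\<Prod>i\<in>I. Q (v i))"
    and "clifford_mu V Q N v (monomial_degree N I) \<in> {1, -1}"
proof -
  let ?e = "(-1) ^ (card I choose 2) * (\<Prod>i\<in>I. Q (v i))"
  \<comment> \<open>The degree determines the index set, so the quantifier inside the description
    ranges over \<open>I\<close> alone.\<close>
  have only: "J = I" if "J \<subseteq> {1..N}" "monomial_degree N J = monomial_degree N I" for J
    using monomial_degree_bij[of N] that I by (auto simp: bij_betw_def dest: inj_onD)
  have "\<bar>?e\<bar> = 1"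
    using I Q by (fastforce simp: abs_mult power_abs abs_prod intro!: prod.neutral)
  then have e: "?e \<in> {1, -1}"
    by auto
  then show "clifford_mu V Q N v (monomial_degree N I) = ?e"
    unfolding clifford_mu_def
    using only clifford_monomial_square[OF I] I by (intro the_equality) (auto simp: sc_inject)
  then show "clifford_mu V Q N v (monomial_degree N I) \<in> {1, -1}"
    using e by simp
qed

lemma Arf_clifford_mu:
  assumes "\<And>i. i \<in> {1..N} \<Longrightarrow> Q (v i) \<in> {1, -1}"
  shows "Arf (Z2_power N) (clifford_mu V Q N v)
           = sgn (\<Sum>I\<in>Pow {1..N}. (-1) ^ (card I choose 2) * (\<Prod>i\<in>I. Q (v i)))"
proof -
  have image: "Z2_power N = monomial_degree N ` Pow {1..N}"
    using monomial_degree_bij[of N] by (simp add: bij_betw_def)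
  have "Arf (Z2_power N) (clifford_mu V Q N v) = sgn (\<Sum>t\<in>Z2_power N. clifford_mu V Q N v t)"
    unfolding image using clifford_mu_eq(2)[OF _ assms] by (intro Arf_eq_sgn_sum) auto
  also have "(\<Sum>t\<in>Z2_power N. clifford_mu V Q N v t)
      = (\<Sum>I\<in>Pow {1..N}. clifford_mu V Q N v (monomial_degree N I))"
    by (rule sum.reindex_bij_betw[OF monomial_degree_bij, symmetric])
  also have "\<dots> = (\<Sum>I\<in>Pow {1..N}. (-1) ^ (card I choose 2) * (\<Prod>i\<in>I. Q (v i)))"
    using clifford_mu_eq(1)[OF _ assms] by (intro sum.cong) auto
  finally show ?thesis .
qed

end

theorem theorem5p9:
  fixes p q :: nat
    and V :: "'v::real_vector set"
    and Q :: "'v \<Rightarrow> real"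
    and v :: "nat \<Rightarrow> 'v"
  assumes "subspace V"
    and "quadratic_form V Q"
    and "orthogonal_basis V Q (p + q) v"
    and "\<And>i. i \<in> {1..p} \<Longrightarrow> Q (v i) = 1"
    and "\<And>i. i \<in> {p+1..p+q} \<Longrightarrow> Q (v i) = -1"
  shows "Arf (Z2_power (p + q)) (clifford_mu V Q (p + q) v)
           = sgn (cos (real_of_int (int p - int q) * pi / 4)
                  + sin (real_of_int (int p - int q) * pi / 4))
       \<and> sgn (cos (real_of_int (int p - int q) * pi / 4)
              + sin (real_of_int (int p - int q) * pi / 4))
           = (if (int p - int q + 1) mod 8 \<in> {1, 2, 3} then 1
              else if (int p - int q + 1) mod 8 \<in> {0, 4} then 0
              else -1)"
proof (intro conjI sgn_cos_plus_sin)
  interpret orthogonal_quadratic_space V Q "p + q" v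
    using assms(1-3) by unfold_locales
  have "Q (v i) \<in> {1, -1}" if "i \<in> {1..p + q}" for i
    using assms(4,5)[of i] that by (cases "i \<le> p") auto
  \<comment> \<open>The power of \<open>sqrt 2\<close> in the sum is positive and disappears under
    \<open>sgn\<close>.\<close>
  from Arf_clifford_mu[OF this] sum_clifford_signs[where d = "\<lambda>i. Q (v i)", OF assms(4,5)]
  show "Arf (Z2_power (p + q)) (clifford_mu V Q (p + q) v)
      = sgn (cos (real_of_int (int p - int q) * pi / 4) + sin (real_of_int (int p - int q) * pi / 4))"
    by (simp only: sgn_mult) simp
qed

end
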